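(* (1) The displacement sequence statistic $\mathrm{Disp}$ is weakly shuffle-compatible on parking functions. (2) Let $\{X_\delta\}_\delta$ be a shuffle basis of $\mathrm{QSym}$. The linear map on $\mathcal{A}^{\mathrm{PF}}_{\mathrm{Disp}}$ defined by $[\alpha]^{\mathrm{PF}}_{\mathrm{Disp}}\mapsto X_{\mathrm{Disp}(\alpha)[1]}$ is an algebra isomorphism between $\mathcal{A}^{\mathrm{PF}}_{\mathrm{Disp}}$ and the subalgebra of $\mathrm{QSym}$ spanned by the basis elements $X_\delta$ where $\delta=(\delta_1,\dots,\delta_k)$ is a finite sequence of positive integers with $\delta_i\le i$ for all $i$.
   Context: All algebras are over $\mathbb{Q}$. A parking function of length $n\ge0$ is a sequence $\alpha=(\alpha_1,\dots,\alpha_n)$ of positive integers whose weakly increasing rearrangement $\alpha'_1\le\dots\le\alpha'_n$ satisfies $\alpha'_i\le i$; $|\alpha|=n$. $\mathrm{PF}_n$ is the set of these and $\mathrm{PF}=\bigcup_{n\ge0}\mathrm{PF}_n$. Parking process: cars $1,\dots,n$ arrive in order on a one-way street with spots $1,\dots,n$; car $i$ parks in the first unoccupied spot $s_i\ge\alpha_i$ (all cars park exactly when $\alpha$ is a parking function). The displacement sequence is $\mathrm{Disp}(\alpha)=(s_1-\alpha_1,\dots,s_n-\alpha_n)$, and $\mathrm{Disp}(\alpha)[1]$ is this sequence with $1$ added to each entry. For $\alpha\in\mathrm{PF}_n,\beta\in\mathrm{PF}_m$, the shifted shuffle $\overrightarrow{\mathrm{Sh}}(\alpha,\beta)$ is the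 set of all interleavings (shuffles) of $\alpha$ and $\beta[n]=(\beta_1+n,\dots,\beta_m+n)$. A statistic $\mathrm{st}$ on $\mathrm{PF}$ is weakly shuffle-compatible on parking functions if for all $\alpha,\beta\in\mathrm{PF}$ the multiset $\{\{\mathrm{st}(\gamma):\gamma\in\overrightarrow{\mathrm{Sh}}(\alpha,\beta)\}\}$ is determined by $|\alpha|,|\beta|,\mathrm{st}(\alpha),\mathrm{st}(\beta)$. Let $[\alpha]^{\mathrm{PF}}_{\mathrm{st}}=\{\beta\in\mathrm{PF}:\mathrm{st}(\beta)=\mathrm{st}(\alpha),|\beta|=|\alpha|\}$. $\mathcal{A}^{\mathrm{PF}}_{\mathrm{st}}$ is the algebra with basis these classes and product $[\alpha]^{\mathrm{PF}}_{\mathrm{st}}[\beta]^{\mathrm{PF}}_{\mathrm{st}}=\sum_{\gamma\in\overrightarrow{\mathrm{Sh}}(\alpha,\beta)}[\gamma]^{\mathrm{PF}}_{\mathrm{st}}$. $\mathrm{QSym}$ is the algebra of quasisymmetric functions. A shuffle basis of $\mathrm{QSym}$ is a basis $\{X_\delta\}$ indexed by all integer compositions $\delta$ (finite sequences of positive integers, including the empty one) with product $X_\delta X_\eta=\sum_{\iota}X_\iota$, the sum over the multiset of all $\binom{k+l}{k}$ interleavings $\iota$ of the sequences $\delta$ and $\eta$, where $k,l$ are the lengths of $\delta,\eta$. Such bases are known to exist. *)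

theory Defs
  imports
    "HOL-Algebra.QuotRing"
    "HOL-Algebra.Module"
    "HOL-Algebra.Algebraic_Closure_Type"
    "HOL-Library.Function_Algebras"
    "HOL-Library.Multiset"
    "HOL-Library.Poly_Mapping"
begin

section \<open>Algebras over the rationals\<close>

abbreviation rat_ring :: "rat ring" where
  "rat_ring \<equiv> ring_of_type_algebra"

text \<open>
  Algebras are unital, and commutative as in the locale \<^locale>\<open>algebra\<close>.
\<close>

definition subalgebra_of :: "('k, 'm) ring_scheme \<Rightarrow> 'a set \<Rightarrow> ('k, 'a, 'n) module_scheme \<Rightarrow> bool" where
  "subalgebra_of K S A \<longleftrightarrow> subring S A \<and> submodule S K A"

definition algebra_iso ::
  "('k, 'm) ring_scheme \<Rightarrow> ('k, 'a, 'n) module_scheme \<Rightarrow> ('k, 'b, 'l) module_scheme \<Rightarrow> ('a \<Rightarrow> 'b) set"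
where
  "algebra_iso K A B =
    {h \<in> ring_iso A B. \<forall>c\<in>carrier K. \<forall>a\<in>carrier A. h (c \<odot>\<^bsub>A\<^esub> a) = c \<odot>\<^bsub>B\<^esub> h a}"


section \<open>Parking functions\<close>

text \<open>
  Sequences are lists, so the entry with (one-based) index \<open>i\<close> is \<open>\<alpha> ! (i - 1)\<close>.
\<close>

definition PF :: "nat list set" where
  "PF = {\<alpha>. 0 \<notin> set \<alpha> \<and> (\<forall>i<length \<alpha>. sort \<alpha> ! i \<le> i + 1)}"

text \<open>
  \<open>park n occ as\<close> lists the spots taken by cars with preferences \<open>as\<close>, arriving in this order on a
  street with spots \<open>1, \<dots>, n\<close> of which those in \<open>occ\<close> are already occupied. If a car cannot park,
  its spot is unspecified; this does not happen for parking functions.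
\<close>

fun park :: "nat \<Rightarrow> nat set \<Rightarrow> nat list \<Rightarrow> nat list" where
  "park n occ [] = []"
| "park n occ (a # as) = (let s = Min ({a..n} - occ) in s # park n (insert s occ) as)"

definition Disp :: "nat list \<Rightarrow> nat list" where
  "Disp \<alpha> = map2 (-) (park (length \<alpha>) {} \<alpha>) \<alpha>"

definition shifted_shuffles :: "nat list \<Rightarrow> nat list \<Rightarrow> nat list set" where
  "shifted_shuffles \<alpha> \<beta> = shuffles \<alpha> (map (\<lambda>b. b + length \<alpha>) \<beta>)"

definition weakly_shuffle_compatible :: "(nat list \<Rightarrow> 's) \<Rightarrow> bool" where
  "weakly_shuffle_compatible st \<longleftrightarrow>
    (\<forall>\<alpha>\<in>PF. \<forall>\<beta>\<in>PF. \<forall>\<alpha>'\<in>PF. \<forall>\<beta>'\<in>PF.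
      length \<alpha> = length \<alpha>' \<and> length \<beta> = length \<beta>' \<and> st \<alpha> = st \<alpha>' \<and> st \<beta> = st \<beta>' \<longrightarrow>
      image_mset st (mset_set (shifted_shuffles \<alpha> \<beta>)) =
      image_mset st (mset_set (shifted_shuffles \<alpha>' \<beta>')))"


section \<open>The shuffle algebra of a statistic\<close>

definition pf_class :: "(nat list \<Rightarrow> 's) \<Rightarrow> nat list \<Rightarrow> nat list set" where
  "pf_class st \<alpha> = {\<beta> \<in> PF. st \<beta> = st \<alpha> \<and> length \<beta> = length \<alpha>}"

abbreviation class_elem :: "(nat list \<Rightarrow> 's) \<Rightarrow> nat list \<Rightarrow> (nat list set \<Rightarrow>\<^sub>0 rat)" where
  "class_elem st \<alpha> \<equiv> Poly_Mapping.single (pf_class st \<alpha>) 1"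

text \<open>
  Elements of the algebra are formal rational linear combinations of classes.
  The product of two classes is computed from chosen representatives; by
  \<open>shuffle_algebra_mult\<close> below the choice is irrelevant when \<open>st\<close> is weakly shuffle-compatible.
\<close>

definition class_prod :: "(nat list \<Rightarrow> 's) \<Rightarrow> nat list set \<Rightarrow> nat list set \<Rightarrow> (nat list set \<Rightarrow>\<^sub>0 rat)" where
  "class_prod st C D =
    (\<Sum>\<gamma> \<in> shifted_shuffles (SOME \<alpha>. \<alpha> \<in> C) (SOME \<beta>. \<beta> \<in> D). class_elem st \<gamma>)"

definition pm_scale :: "rat \<Rightarrow> ('a \<Rightarrow>\<^sub>0 rat) \<Rightarrow> ('a \<Rightarrow>\<^sub>0 rat)" where
  "pm_scale c p = Poly_Mapping.map ((*) c) p"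

definition shuffle_algebra :: "(nat list \<Rightarrow> 's) \<Rightarrow> (rat, nat list set \<Rightarrow>\<^sub>0 rat) module" where
  "shuffle_algebra st =
    \<lparr> carrier = {p. Poly_Mapping.keys p \<subseteq> pf_class st ` PF},
      monoid.mult = (\<lambda>p q. \<Sum>C \<in> Poly_Mapping.keys p. \<Sum>D \<in> Poly_Mapping.keys q.
        pm_scale (Poly_Mapping.lookup p C * Poly_Mapping.lookup q D) (class_prod st C D)),
      one = class_elem st [],
      ring.zero = 0,
      add = (+),
      module.smult = pm_scale \<rparr>"

lemma shuffle_algebra_mult:
  assumes "weakly_shuffle_compatible st" "\<alpha> \<in> PF" "\<beta> \<in> PF"
  shows "class_elem st \<alpha> \<otimes>\<^bsub>shuffle_algebra st\<^esub> class_elem st \<beta> =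
    (\<Sum>\<gamma> \<in> shifted_shuffles \<alpha> \<beta>. class_elem st \<gamma>)"
proof -
  define \<alpha>' \<beta>' where "\<alpha>' = (SOME x. x \<in> pf_class st \<alpha>)" and "\<beta>' = (SOME x. x \<in> pf_class st \<beta>)"
  have self: "x \<in> pf_class st x" if "x \<in> PF" for x
    using that by (simp add: pf_class_def)
  have "\<alpha>' \<in> pf_class st \<alpha>" "\<beta>' \<in> pf_class st \<beta>"
    unfolding \<alpha>'_def \<beta>'_def
    using someI[where P = "\<lambda>x. x \<in> pf_class st \<alpha>", OF self[OF assms(2)]]
      someI[where P = "\<lambda>x. x \<in> pf_class st \<beta>", OF self[OF assms(3)]] by simp_all
  then have *: "\<alpha>' \<in> PF" "\<beta>' \<in> PF" "length \<alpha>' = length \<alpha>" "length \<beta>' = length \<beta>"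
    "st \<alpha>' = st \<alpha>" "st \<beta>' = st \<beta>"
    by (auto simp: pf_class_def)
  define F :: "'a \<Rightarrow> (nat list set \<Rightarrow>\<^sub>0 rat)" where
    "F s = Poly_Mapping.single {\<gamma> \<in> PF. st \<gamma> = s \<and> length \<gamma> = length \<alpha> + length \<beta>} 1" for s
  have F: "(\<Sum>\<gamma> \<in> shifted_shuffles a b. class_elem st \<gamma>) =
      (\<Sum>s \<in># image_mset st (mset_set (shifted_shuffles a b)). F s)"
    if "length a = length \<alpha>" "length b = length \<beta>" for a b
  proof -
    have "class_elem st \<gamma> = F (st \<gamma>)" if "\<gamma> \<in> shifted_shuffles a b" for \<gamma>
      using that \<open>length a = length \<alpha>\<close> \<open>length b = length \<beta>\<close>
      by (auto simp: F_def pf_class_def shifted_shuffles_def dest!: length_shuffles)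
    then show ?thesis
      by (simp add: sum_unfold_sum_mset image_mset.compositionality comp_def)
  qed
  have eq: "image_mset st (mset_set (shifted_shuffles \<alpha>' \<beta>')) =
      image_mset st (mset_set (shifted_shuffles \<alpha> \<beta>))"
    using assms * unfolding weakly_shuffle_compatible_def by blast
  have [simp]: "pm_scale 1 p = p" for p :: "nat list set \<Rightarrow>\<^sub>0 rat"
    by (rule poly_mapping_eqI) (simp add: pm_scale_def map.rep_eq when_def)
  have "class_elem st \<alpha> \<otimes>\<^bsub>shuffle_algebra st\<^esub> class_elem st \<beta> =
      (\<Sum>\<gamma> \<in> shifted_shuffles \<alpha>' \<beta>'. class_elem st \<gamma>)"
    by (simp add: shuffle_algebra_def class_prod_def \<alpha>'_def \<beta>'_def)
  also have "\<dots> = (\<Sum>\<gamma> \<in> shifted_shuffles \<alpha> \<beta>. class_elem st \<gamma>)"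
    unfolding F[OF *(3,4)] F[OF refl refl] eq ..
  finally show ?thesis .
qed


section \<open>Quasisymmetric functions\<close>

text \<open>
  A formal power series in \<open>x\<^sub>0, x\<^sub>1, x\<^sub>2, \<dots>\<close> is given by its coefficients; monomials are
  multisets of variable indices, so that the degree of a monomial is its size.
  Addition is the pointwise one; multiplication and the unit are not.
\<close>

type_synonym pser = "nat multiset \<Rightarrow> rat"

definition pser_scale :: "rat \<Rightarrow> pser \<Rightarrow> pser" where
  "pser_scale c f = (\<lambda>m. c * f m)"

definition pser_mult :: "pser \<Rightarrow> pser \<Rightarrow> pser" where
  "pser_mult f g = (\<lambda>m. \<Sum>a | a \<subseteq># m. f a * g (m - a))"

definition pser_one :: pser where
  "pser_one = (\<lambda>m. if m = {#} then 1 else 0)"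

global_interpretation pser: vector_space pser_scale
  by standard (auto simp: pser_scale_def fun_eq_iff algebra_simps)

text \<open>
  \<open>monomial vs es\<close> is the product of the variables with indices \<open>vs\<close> raised to the exponents \<open>es\<close>.
\<close>

definition monomial :: "nat list \<Rightarrow> nat list \<Rightarrow> nat multiset" where
  "monomial vs es = (\<Sum>(i, a) \<leftarrow> zip vs es. replicate_mset a i)"

definition compositions :: "nat list set" where
  "compositions = {\<delta>. 0 \<notin> set \<delta>}"

definition quasisymmetric :: "pser \<Rightarrow> bool" where
  "quasisymmetric f \<longleftrightarrow>
    (\<exists>d. \<forall>m. f m \<noteq> 0 \<longrightarrow> size m \<le> d) \<and>
    (\<forall>es\<in>compositions. \<forall>vs ws. length vs = length es \<and> length ws = length es \<and>
      sorted_wrt (<) vs \<and> sorted_wrt (<) ws \<longrightarrow> f (monomial vs es) = f (monomial ws es))"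

definition QSym :: "(rat, pser) module" where
  "QSym =
    \<lparr> carrier = {f. quasisymmetric f},
      monoid.mult = pser_mult,
      one = pser_one,
      ring.zero = 0,
      add = (+),
      module.smult = pser_scale \<rparr>"


lemma finite_submultisets: "finite {a. a \<subseteq># (m :: 'a multiset)}"
proof (rule finite_subset)
  show "{a. a \<subseteq># m} \<subseteq> mset ` {xs. set xs \<subseteq> set_mset m \<and> length xs \<le> size m}"
  proof
    fix a assume "a \<in> {a. a \<subseteq># m}"
    then have a: "a \<subseteq># m" by simp
    obtain xs where xs: "mset xs = a" using ex_mset by blast
    then have "set xs \<subseteq> set_mset m" "length xs \<le> size m"
      using a set_mset_mono[OF a] size_mset_mono[OF a] by (auto simp flip: set_mset_mset size_mset)
    then show "a \<in> mset ` {xs. set xs \<subseteq> set_mset m \<and> length xs \<le> size m}"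
      using xs by blast
  qed
qed (simp add: finite_lists_length_le)

lemma pser_mult_commute: "pser_mult f g = pser_mult g f"
proof
  fix m
  show "pser_mult f g m = pser_mult g f m"
    unfolding pser_mult_def
    by (rule sum.reindex_bij_witness[of _ "\<lambda>a. m - a" "\<lambda>a. m - a"])
       (auto simp: subset_mset.diff_diff_right mult.commute)
qed

lemma pser_mult_assoc: "pser_mult (pser_mult f g) h = pser_mult f (pser_mult g h)"
proof
  fix m
  have "pser_mult (pser_mult f g) h m =
      (\<Sum>(a, b) \<in> (SIGMA a : {a. a \<subseteq># m}. {b. b \<subseteq># a}). f b * g (a - b) * h (m - a))"
    by (simp add: pser_mult_def sum_distrib_right sum.Sigma finite_submultisets)
  also have "\<dots> = (\<Sum>(b, c) \<in> (SIGMA b : {b. b \<subseteq># m}. {c. c \<subseteq># m - b}). f b * (g c * h (m - b - c)))"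
  proof (rule sum.reindex_bij_witness[of _ "\<lambda>(b, c). (b + c, b)" "\<lambda>(a, b). (b, a - b)"])
    fix x assume x: "x \<in> (SIGMA a : {a. a \<subseteq># m}. {b. b \<subseteq># a})"
    then obtain a b where ab: "x = (a, b)" "a \<subseteq># m" "b \<subseteq># a" by auto
    then obtain c e where "a = b + c" "m = b + c + e"
      by (auto simp: subset_mset.le_iff_add)
    then show "(case case x of (a, b) \<Rightarrow> (b, a - b) of (b, c) \<Rightarrow> (b + c, b)) = x"
      "(case x of (a, b) \<Rightarrow> (b, a - b)) \<in> (SIGMA b : {b. b \<subseteq># m}. {c. c \<subseteq># m - b})"
      "(case case x of (a, b) \<Rightarrow> (b, a - b) of (b, c) \<Rightarrow> f b * (g c * h (m - b - c))) =
        (case x of (a, b) \<Rightarrow> f b * g (a - b) * h (m - a))"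
      by (simp_all add: ab(1) mult.assoc)
  next
    fix x assume x: "x \<in> (SIGMA b : {b. b \<subseteq># m}. {c. c \<subseteq># m - b})"
    then obtain b c where bc: "x = (b, c)" "b \<subseteq># m" "c \<subseteq># m - b" by auto
    then obtain e where "m = b + c + e"
      by (auto simp: subset_mset.le_iff_add)
    then show "(case case x of (b, c) \<Rightarrow> (b + c, b) of (a, b) \<Rightarrow> (b, a - b)) = x"
      "(case x of (b, c) \<Rightarrow> (b + c, b)) \<in> (SIGMA a : {a. a \<subseteq># m}. {b. b \<subseteq># a})"
      by (simp_all add: bc(1))
  qed
  also have "\<dots> = pser_mult f (pser_mult g h) m"
    by (simp add: pser_mult_def sum_distrib_left sum.Sigma finite_submultisets)
  finally show "pser_mult (pser_mult f g) h m = pser_mult f (pser_mult g h) m" .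
qed

lemma pser_mult_one: "pser_mult pser_one f = f"
proof
  fix m
  have "pser_mult pser_one f m = (\<Sum>a\<in>{a. a \<subseteq># m}. if a = {#} then f m else 0)"
    unfolding pser_mult_def by (rule sum.cong) (auto simp: pser_one_def)
  then show "pser_mult pser_one f m = f m"
    by (simp add: finite_submultisets)
qed

lemma pser_mult_add: "pser_mult (f + g) h = pser_mult f h + pser_mult g h"
  by (simp add: fun_eq_iff pser_mult_def algebra_simps sum.distrib)

lemma pser_mult_scale: "pser_mult (pser_scale c f) g = pser_scale c (pser_mult f g)"
  by (simp add: fun_eq_iff pser_mult_def pser_scale_def sum_distrib_left mult.assoc)

lemma image_mset_monomial: "image_mset r (monomial vs es) = monomial (map r vs) es"
  unfolding monomial_def
proof (induction vs es rule: list_induct2')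
qed auto

lemma set_monomial_subset: "set_mset (monomial vs es) \<subseteq> set vs"
  unfolding monomial_def
proof (induction vs es rule: list_induct2')
qed (auto split: if_splits)

lemma monomial_count: "distinct vs \<Longrightarrow> set vs = set_mset m \<Longrightarrow> monomial vs (map (count m) vs) = m"
proof (induction vs arbitrary: m)
  case (Cons i vs)
  define m' where "m' = filter_mset (\<lambda>j. j \<noteq> i) m"
  have 1: "set vs = set_mset m'" "map (count m') vs = map (count m) vs"
    using Cons.prems by (auto simp: m'_def)
  have "m = replicate_mset (count m i) i + m'"
    by (rule multiset_eqI) (auto simp: m'_def)
  with Cons.IH[OF _ 1(1)] Cons.prems 1(2) show ?case
    by (auto simp: monomial_def)
qed (auto simp: monomial_def dest: sym)

lemma quasisymmetric_iff:
  "quasisymmetric f \<longleftrightarrow>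
    (\<exists>d. \<forall>m. f m \<noteq> 0 \<longrightarrow> size m \<le> d) \<and>
    (\<forall>m r. strict_mono_on (set_mset m) r \<longrightarrow> f (image_mset r m) = f m)"
proof -
  have "f (image_mset r m) = f m"
    if f: "quasisymmetric f" and r: "strict_mono_on (set_mset m) r"
    for m and r :: "nat \<Rightarrow> nat"
  proof -
    define vs where "vs = sorted_list_of_set (set_mset m)"
    have vs: "distinct vs" "set vs = set_mset m" "sorted_wrt (<) vs"
      by (simp_all add: vs_def)
    have m: "monomial vs (map (count m) vs) = m"
      by (rule monomial_count) fact+
    have "sorted_wrt (<) (map r vs)"
      unfolding sorted_wrt_map using vs(3)
      by (rule sorted_wrt_mono_rel[rotated]) (use r vs(2) in \<open>auto simp: strict_mono_on_def\<close>)
    moreover have "map (count m) vs \<in> compositions"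
      using vs(2) by (auto simp: compositions_def count_eq_zero_iff)
    moreover have "length (map r vs) = length (map (count m) vs)" "length vs = length (map (count m) vs)"
      by simp_all
    ultimately have "f (monomial (map r vs) (map (count m) vs)) = f (monomial vs (map (count m) vs))"
      using f vs(3) unfolding quasisymmetric_def by blast
    then show ?thesis
      unfolding image_mset_monomial[symmetric] m .
  qed
  note 1 = this
  have "f (monomial vs es) = f (monomial ws es)"
    if *: "\<forall>m (r :: nat \<Rightarrow> nat). strict_mono_on (set_mset m) r \<longrightarrow> f (image_mset r m) = f m"
      "length vs = length es" "length ws = length es" "sorted_wrt (<) vs" "sorted_wrt (<) ws"
    for vs ws es
  proof -
    define r where "r x = the (map_of (zip vs ws) x)" for x
    have len: "length vs = length ws"
      using *(2,3) by simp
    have "distinct vs"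
      using *(4) by (simp add: strict_sorted_iff)
    then have r: "r (vs ! k) = ws ! k" if "k < length vs" for k
      using that len by (simp add: r_def map_of_zip_nth)
    have "map r vs = ws"
      by (rule nth_equalityI) (simp_all add: len r)
    have "strict_mono_on (set vs) r"
    proof (rule strict_mono_onI)
      fix x y assume "x \<in> set vs" "y \<in> set vs" "x < y"
      then obtain k l where kl: "k < length vs" "l < length vs" "x = vs ! k" "y = vs ! l"
        by (auto simp: in_set_conv_nth)
      have "k < l"
      proof (rule ccontr)
        assume "\<not> k < l"
        then have "l < k \<or> l = k" by auto
        then have "y \<le> x"
          using kl sorted_wrt_nth_less[OF *(4), of l k] by auto
        with \<open>x < y\<close> show False
          by simp
      qed
      then show "r x < r y"
        using kl(1,2) len by (simp add: kl(3,4) r sorted_wrt_nth_less[OF *(5)])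
    qed
    then have "strict_mono_on (set_mset (monomial vs es)) r"
      using set_monomial_subset by (rule monotone_on_subset)
    then have "f (image_mset r (monomial vs es)) = f (monomial vs es)"
      using *(1) by blast
    then show ?thesis
      unfolding image_mset_monomial \<open>map r vs = ws\<close> ..
  qed
  note 2 = this
  show ?thesis
  proof (intro iffI conjI allI impI)
    assume "quasisymmetric f"
    then show "\<exists>d. \<forall>m. f m \<noteq> 0 \<longrightarrow> size m \<le> d"
      unfolding quasisymmetric_def by (rule conjunct1)
  next
    fix m and r :: "nat \<Rightarrow> nat" assume "quasisymmetric f" "strict_mono_on (set_mset m) r"
    then show "f (image_mset r m) = f m" by (rule 1)
  next
    assume *: "(\<exists>d. \<forall>m. f m \<noteq> 0 \<longrightarrow> size m \<le> d) \<and>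
      (\<forall>m r. strict_mono_on (set_mset m) r \<longrightarrow> f (image_mset r m) = f m)"
    show "quasisymmetric f"
      unfolding quasisymmetric_def
      by (intro conjI ballI allI impI conjunct1[OF *]; elim conjE; rule 2[OF conjunct2[OF *]])
  qed
qed

lemma quasisymmetric_mult:
  assumes f: "quasisymmetric f" and g: "quasisymmetric g"
  shows "quasisymmetric (pser_mult f g)"
proof -
  from f obtain d where d: "\<And>m. f m \<noteq> 0 \<Longrightarrow> size m \<le> d"
    unfolding quasisymmetric_def by blast
  from g obtain e where e: "\<And>m. g m \<noteq> 0 \<Longrightarrow> size m \<le> e"
    unfolding quasisymmetric_def by blast
  have "size m \<le> d + e" if nz: "pser_mult f g m \<noteq> 0" for m
  proof -
    obtain a where a: "a \<subseteq># m" "f a * g (m - a) \<noteq> 0"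
      using sum.not_neutral_contains_not_neutral[OF nz[unfolded pser_mult_def]] by blast
    with d[of a] e[of "m - a"] show ?thesis
      by (auto simp: size_Diff_submset)
  qed
  moreover have "pser_mult f g (image_mset r m) = pser_mult f g m"
    if r: "strict_mono_on (set_mset m) r" for m r
  proof -
    have inj: "inj_on r (set_mset m)"
      using r by (rule strict_mono_on_imp_inj_on)
    define s where "s = the_inv_into (set_mset m) r"
    have s: "image_mset s (image_mset r a) = a" if "a \<subseteq># m" for a
    proof -
      have "image_mset (s \<circ> r) a = image_mset id a"
        using set_mset_mono[OF that] inj
        by (intro image_mset_cong) (auto simp: s_def the_inv_into_f_f)
      then show ?thesis
        by (simp add: image_mset.compositionality)
    qed
    have "bij_betw (image_mset r) {a. a \<subseteq># m} {a. a \<subseteq># image_mset r m}"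
    proof (rule bij_betw_imageI)
      show "inj_on (image_mset r) {a. a \<subseteq># m}"
        by (rule inj_on_inverseI[of _ "image_mset s"]) (simp add: s)
      show "image_mset r ` {a. a \<subseteq># m} = {a. a \<subseteq># image_mset r m}"
      proof (intro equalityI subsetI)
        fix b assume "b \<in> {a. a \<subseteq># image_mset r m}"
        then obtain c where "image_mset r m = b + c"
          by (auto simp: subset_mset.le_iff_add)
        then obtain a a' where "m = a + a'" "b = image_mset r a"
          by (auto dest!: image_mset_eq_plusD)
        then show "b \<in> image_mset r ` {a. a \<subseteq># m}"
          by auto
      qed (auto intro: image_mset_subseteq_mono)
    qed
    then have "pser_mult f g (image_mset r m) =
        (\<Sum>a | a \<subseteq># m. f (image_mset r a) * g (image_mset r m - image_mset r a))"
      unfolding pser_mult_def by (rule sum.reindex_bij_betw[symmetric])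
    also have "\<dots> = pser_mult f g m"
      unfolding pser_mult_def
    proof (rule sum.cong)
      fix a assume "a \<in> {a. a \<subseteq># m}"
      then have a: "a \<subseteq># m" by simp
      have "strict_mono_on (set_mset a) r" "strict_mono_on (set_mset (m - a)) r"
        using monotone_on_subset[OF r set_mset_mono[OF a]]
          monotone_on_subset[OF r set_mset_mono[OF diff_subset_eq_self[of m a]]]
        by simp_all
      then have "f (image_mset r a) = f a" "g (image_mset r (m - a)) = g (m - a)"
        using f g unfolding quasisymmetric_iff by blast+
      then show "f (image_mset r a) * g (image_mset r m - image_mset r a) = f a * g (m - a)"
        by (simp add: image_mset_Diff[OF a])
    qed simp
    finally show ?thesis .
  qed
  ultimately show ?thesis
    unfolding quasisymmetric_iff by blast
qed

lemma quasisymmetric_add: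
  assumes "quasisymmetric f" "quasisymmetric g"
  shows "quasisymmetric (f + g)"
proof -
  from assms obtain d e where "\<And>m. f m \<noteq> 0 \<Longrightarrow> size m \<le> d" "\<And>m. g m \<noteq> 0 \<Longrightarrow> size m \<le> e"
    by (auto simp: quasisymmetric_def)
  then have "\<And>m. (f + g) m \<noteq> 0 \<Longrightarrow> size m \<le> max d e"
    by (metis add_0 max.coboundedI1 max.coboundedI2 plus_fun_apply)
  with assms show ?thesis
    unfolding quasisymmetric_iff by auto
qed

lemma quasisymmetric_scale: "quasisymmetric f \<Longrightarrow> quasisymmetric (pser_scale c f)"
  unfolding quasisymmetric_iff pser_scale_def by auto

lemma cring_QSym: "cring QSym"
proof (intro cringI abelian_groupI comm_monoidI)
  fix f assume f: "f \<in> carrier QSym"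
  then show "\<exists>g\<in>carrier QSym. g \<oplus>\<^bsub>QSym\<^esub> f = \<zero>\<^bsub>QSym\<^esub>"
    using quasisymmetric_scale[of f "-1"]
    by (intro bexI[of _ "pser_scale (-1) f"]) (auto simp: QSym_def pser_scale_def fun_eq_iff)
next
  show "\<one>\<^bsub>QSym\<^esub> \<in> carrier QSym" "\<zero>\<^bsub>QSym\<^esub> \<in> carrier QSym"
    by (auto simp: QSym_def quasisymmetric_iff pser_one_def)
next
  fix f g h
  show "f \<oplus>\<^bsub>QSym\<^esub> g = g \<oplus>\<^bsub>QSym\<^esub> f"
    by (simp add: QSym_def add.commute)
  show "f \<otimes>\<^bsub>QSym\<^esub> g = g \<otimes>\<^bsub>QSym\<^esub> f"
    by (simp add: QSym_def pser_mult_commute[of f g])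
qed (simp_all add: QSym_def quasisymmetric_add quasisymmetric_mult add.assoc pser_mult_assoc
      pser_mult_one pser_mult_add)

lemma algebra_QSym: "algebra rat_ring QSym"
proof (rule algebraI[OF _ cring_QSym])
  show "cring rat_ring"
    by (rule cring_from_type_algebra)
qed (simp_all add: QSym_def ring_of_type_algebra_def quasisymmetric_scale pser.scale_left_distrib
      pser.scale_right_distrib pser_mult_scale)


section \<open>Shuffle bases\<close>

text \<open>The multiset of all interleavings; unlike \<^const>\<open>shuffles\<close> it keeps multiplicities.\<close>

fun mshuffles :: "'a list \<Rightarrow> 'a list \<Rightarrow> 'a list multiset" where
  "mshuffles [] ys = {#ys#}"
| "mshuffles xs [] = {#xs#}"
| "mshuffles (x # xs) (y # ys) =
    image_mset ((#) x) (mshuffles xs (y # ys)) + image_mset ((#) y) (mshuffles (x # xs) ys)"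

lemma set_mset_mshuffles: "set_mset (mshuffles xs ys) = shuffles xs ys"
  by (induction xs ys rule: mshuffles.induct) auto

lemma size_mshuffles: "size (mshuffles xs ys) = (length xs + length ys) choose length xs"
  by (induction xs ys rule: mshuffles.induct) auto

definition shuffle_basis :: "(nat list \<Rightarrow> pser) \<Rightarrow> bool" where
  "shuffle_basis B \<longleftrightarrow>
    inj_on B compositions \<and> pser.independent (B ` compositions) \<and>
    pser.span (B ` compositions) = carrier QSym \<and>
    (\<forall>\<delta>\<in>compositions. \<forall>\<eta>\<in>compositions. B \<delta> \<otimes>\<^bsub>QSym\<^esub> B \<eta> = (\<Sum>\<iota> \<in># mshuffles \<delta> \<eta>. B \<iota>))"

text \<open>With one-based indices the condition below reads \<open>\<delta>\<^sub>i \<le> i\<close>.\<close>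

definition bounded_compositions :: "nat list set" where
  "bounded_compositions = {\<delta> \<in> compositions. \<forall>i<length \<delta>. \<delta> ! i \<le> i + 1}"

end

theory Submission
  imports Defs
begin

text \<open>
  In a shifted shuffle the cars of \<open>\<alpha>\<close> fill the spots \<open>1, \<dots>, n\<close> and those of \<open>\<beta>[n]\<close> the spots
  after \<open>n\<close>, so the two groups do not interact: the displacements of an interleaving are the
  corresponding interleaving of the displacements. Displacement sequences of parking functions
  are exactly the sequences whose \<open>i\<close>-th entry is less than \<open>i\<close>, so sending a class to its basis
  element is a bijection onto a basis of the span, and it turns the product of classes
  into the product of a shuffle basis. The algebra axioms and the closure of the span under
  multiplication are transported along this map.
\<close>

section \<open>Counting characterization of parking functions\<close>

text \<open>If each sorted entry at index \<open>i\<close> is at most \<open>i + 1\<close>, the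
  entries above \<open>k\<close> sit at indices from \<open>k\<close> on. Conversely, a violation at
  \<open>i\<close> makes all \<open>length \<alpha> - i\<close> entries from there on exceed
  \<open>i + 1\<close>, one too many. Unlike sorting, counting is additive over shuffles.\<close>

lemma PF_iff_count:
  "\<alpha> \<in> PF \<longleftrightarrow> 0 \<notin> set \<alpha> \<and> (\<forall>k. length (filter (\<lambda>a. k < a) \<alpha>) \<le> length \<alpha> - k)"
proof -
  have count: "length (filter P \<alpha>) = card {i. i < length \<alpha> \<and> P (sort \<alpha> ! i)}" for P
  proof -
    have "length (filter P \<alpha>) = length (filter P (sort \<alpha>))"
      by (simp add: filter_sort)
    then show ?thesis
      by (simp add: length_filter_conv_card)
  qed
  have "(\<forall>i<length \<alpha>. sort \<alpha> ! i \<le> i + 1) \<longleftrightarrow>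
    (\<forall>k. length (filter (\<lambda>a. k < a) \<alpha>) \<le> length \<alpha> - k)"
  proof (intro iffI allI impI)
    fix k assume *: "\<forall>i<length \<alpha>. sort \<alpha> ! i \<le> i + 1"
    have "{i. i < length \<alpha> \<and> k < sort \<alpha> ! i} \<subseteq> {k..<length \<alpha>}"
      using * by fastforce
    then have "card {i. i < length \<alpha> \<and> k < sort \<alpha> ! i} \<le> card {k..<length \<alpha>}"
      by (intro card_mono) auto
    then show "length (filter (\<lambda>a. k < a) \<alpha>) \<le> length \<alpha> - k"
      by (simp add: count)
  next
    fix i assume *: "\<forall>k. length (filter (\<lambda>a. k < a) \<alpha>) \<le> length \<alpha> - k" and i: "i < length \<alpha>"
    show "sort \<alpha> ! i \<le> i + 1"
    proof (rule ccontr)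
      assume "\<not> sort \<alpha> ! i \<le> i + 1"
      then have "i + 1 < sort \<alpha> ! j" if "i \<le> j" "j < length \<alpha>" for j
        using that sorted_nth_mono[of "sort \<alpha>" i j] by simp
      then have "{i..<length \<alpha>} \<subseteq> {j. j < length \<alpha> \<and> i + 1 < sort \<alpha> ! j}"
        by auto
      then have "card {i..<length \<alpha>} \<le> card {j. j < length \<alpha> \<and> i + 1 < sort \<alpha> ! j}"
        by (intro card_mono) auto
      also have "\<dots> \<le> length \<alpha> - (i + 1)"
        using * by (simp flip: count)
      finally show False
        using i by simp
    qed
  qed
  then show ?thesis
    by (auto simp: PF_def)
qed

lemma length_filter_shuffles:
  "zs \<in> shuffles xs ys \<Longrightarrow>
    length (filter P zs) = length (filter P xs) + length (filter P ys)"
  using length_shuffles filter_shuffles by blast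

text \<open>Counts above a threshold \<open>k\<close> add over the two lists. For \<open>k\<close>
  below \<open>length \<alpha>\<close> all of the shifted list may count; from there on
  \<open>\<alpha>\<close> contributes nothing and the shifted list obeys the condition on
  \<open>\<beta>\<close> at \<open>k - length \<alpha>\<close>.\<close>

lemma shifted_shuffles_PF:
  assumes "\<alpha> \<in> PF" "\<beta> \<in> PF" "\<gamma> \<in> shifted_shuffles \<alpha> \<beta>"
  shows "\<gamma> \<in> PF"
proof -
  let ?n = "length \<alpha>" and ?m = "length \<beta>"
  have \<gamma>: "\<gamma> \<in> shuffles \<alpha> (map (\<lambda>b. b + ?n) \<beta>)"
    using assms(3) by (simp add: shifted_shuffles_def)
  have "length (filter (\<lambda>a. k < a) \<gamma>) \<le> length \<gamma> - k" for k
  proof -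
    have len: "length \<gamma> = ?n + ?m"
      using length_shuffles[OF \<gamma>] by simp
    have 1: "length (filter (\<lambda>a. k < a) \<alpha>) \<le> ?n - k"
      using assms(1) by (auto simp: PF_iff_count)
    have 2: "length (filter (\<lambda>b. k < b) (map (\<lambda>b. b + ?n) \<beta>)) \<le> ?m - (k - ?n)"
    proof (cases "?n \<le> k")
      case True
      then have "(\<lambda>b. k < b + ?n) = (\<lambda>b. k - ?n < b)"
        by auto
      then show ?thesis
        using assms(2) by (auto simp: PF_iff_count filter_map comp_def)
    next
      case False
      then show ?thesis
        using length_filter_le[of "\<lambda>b. k < b" "map (\<lambda>b. b + ?n) \<beta>"] by simp
    qed
    show ?thesis
      unfolding length_filter_shuffles[OF \<gamma>] len using 1 2 by linarith
  qed
  moreover have "0 \<notin> set \<gamma>"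
    using assms(1,2) set_shuffles[OF \<gamma>] by (auto simp: PF_def)
  ultimately show ?thesis
    by (simp add: PF_iff_count)
qed


section \<open>The parking process from an arbitrary state\<close>

text \<open>Street length and occupied set are kept as parameters so that inductions can follow the
  cars one by one.\<close>

definition disp :: "nat \<Rightarrow> nat set \<Rightarrow> nat list \<Rightarrow> nat list" where
  "disp n occ as = map2 (-) (park n occ as) as"

lemma disp_Nil [simp]: "disp n occ [] = []"
  by (simp add: disp_def)

lemma disp_Cons [simp]:
  "disp n occ (a # as) =
    (Min ({a..n} - occ) - a) # disp n (insert (Min ({a..n} - occ)) occ) as"
  by (simp add: disp_def Let_def)

lemma length_disp [simp]: "length (disp n occ as) = length as"
  by (induction as arbitrary: occ) auto

lemma Disp_eq_disp: "Disp \<alpha> = disp (length \<alpha>) {} \<alpha>"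
  by (simp add: Disp_def disp_def)

lemma length_Disp [simp]: "length (Disp \<alpha>) = length \<alpha>"
  by (simp add: Disp_eq_disp)

text \<open>
  The last condition is the Hall condition for matching the remaining cars with free spots.
  It survives each arrival, so every car parks.
\<close>

definition parkable :: "nat \<Rightarrow> nat set \<Rightarrow> nat list \<Rightarrow> bool" where
  "parkable n occ as \<longleftrightarrow> occ \<subseteq> {1..n} \<and> 0 \<notin> set as \<and>
    (\<forall>k. length (filter (\<lambda>a. k < a) as) \<le> card ({k<..n} - occ))"

section \<open>Every car parks; the range of displacements\<close>

lemma parkable_PF: "\<alpha> \<in> PF \<Longrightarrow> parkable (length \<alpha>) {} \<alpha>"
  by (simp add: parkable_def PF_iff_count)

text \<open>The Hall condition at \<open>a - 1\<close> counts the arriving car itself, so some spot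
  from \<open>a\<close> on is free and the minimum is over a nonempty set.\<close>

lemma parkable_spot:
  assumes "parkable n occ (a # as)"
  shows "Min ({a..n} - occ) \<in> {a..n} - occ"
proof (rule Min_in)
  have "0 < a" and *: "length (filter (\<lambda>b. a - 1 < b) (a # as)) \<le> card ({a - 1<..n} - occ)"
    using assms unfolding parkable_def by (auto simp del: filter.simps)
  from \<open>0 < a\<close> have "{a - 1<..n} = {a..n}"
    by auto
  with * \<open>0 < a\<close> show "{a..n} - occ \<noteq> {}"
    by (metis card.empty diff_less filter.simps(2) le_zero_eq length_Cons nat.distinct(1) zero_less_one)
qed simp

lemma below_parked_spot:
  fixes n :: nat
  assumes "a \<le> j" "j < Min ({a..n} - occ)" "Min ({a..n} - occ) \<le> n"
  shows "j \<in> occ"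
proof (rule ccontr)
  assume "j \<notin> occ"
  with assms(1,2,3) have "Min ({a..n} - occ) \<le> j"
    by (intro Min_le) auto
  with assms(2) show False by simp
qed

text \<open>Let \<open>s\<close> be the newly taken spot. Thresholds from \<open>s\<close> on see
  the same free spots as before. For thresholds below \<open>a\<close>, the loss of \<open>s\<close>
  is matched by the arriving car leaving the count.\<close>

lemma parkable_step:
  assumes "parkable n occ (a # as)"
  shows "parkable n (insert (Min ({a..n} - occ)) occ) as"
proof -
  define s where "s = Min ({a..n} - occ)"
  have s: "s \<in> {a..n} - occ"
    unfolding s_def by (rule parkable_spot[OF assms])
  have a: "0 < a" and hall: "length (filter (\<lambda>b. k < b) (a # as)) \<le> card ({k<..n} - occ)" for k
    using assms unfolding parkable_def by auto
  have "length (filter (\<lambda>b. k < b) as) \<le> card ({k<..n} - insert s occ)" for k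
  proof -
    have card: "card ({k<..n} - insert s occ) = card ({k<..n} - occ) - 1" if "k < s"
      using that s by (subst Diff_insert) (auto intro!: card_Diff_singleton)
    consider "s \<le> k" | "k < a" | "a \<le> k" "k < s" by linarith
    then show ?thesis
    proof cases
      case 1
      then have "{k<..n} - insert s occ = {k<..n} - occ" by auto
      with hall[of k] show ?thesis
        by (auto split: if_splits)
    next
      case 2
      with hall[of k] card s show ?thesis by auto
    next
      case 3
      text \<open>All spots from \<open>a\<close> to \<open>k\<close> are taken, so the condition at \<open>a - 1\<close> is sharper by one.\<close>
      have "j \<in> occ" if "a \<le> j" "j < s" for j
        using below_parked_spot[of a j n occ] that s by (simp add: s_def)
      then have "{a - 1<..n} - occ = {k<..n} - occ"
        using 3 a by (auto simp: not_less) (metis Suc_leI Suc_pred not_less le_less_trans)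
      moreover have "length (filter (\<lambda>b. k < b) as) \<le> length (filter (\<lambda>b. a - 1 < b) as)"
      proof -
        have "filter (\<lambda>b. k < b) as = filter (\<lambda>b. k < b) (filter (\<lambda>b. a - 1 < b) as)"
          using 3 by (auto intro!: filter_cong)
        then show ?thesis
          by (metis length_filter_le)
      qed
      ultimately show ?thesis
        using hall[of "a - 1"] card 3 a by simp
    qed
  qed
  then show ?thesis
    using assms s a unfolding parkable_def s_def[symmetric] by auto
qed

text \<open>All spots from the preference to just before the spot taken are occupied, so a
  displacement is at most the number of parked cars, which grows by one per arrival.\<close>

lemma disp_bound:
  "parkable n occ as \<Longrightarrow> i < length as \<Longrightarrow> disp n occ as ! i \<le> card occ + i"
proof (induction as arbitrary: occ i)
  case (Cons a as)
  define s where "s = Min ({a..n} - occ)"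
  have s: "s \<in> {a..n} - occ"
    unfolding s_def by (rule parkable_spot[OF Cons.prems(1)])
  have fin: "finite occ"
    using Cons.prems(1) unfolding parkable_def by (blast intro: finite_subset)
  have "{a..<s} \<subseteq> occ"
    using below_parked_spot[of a _ n occ] s by (auto simp: s_def)
  then have "s - a \<le> card occ"
    using card_mono[OF fin, of "{a..<s}"] by simp
  moreover have "disp n (insert s occ) as ! j \<le> card occ + Suc j" if "j < length as" for j
    using Cons.IH[OF parkable_step[OF Cons.prems(1)] that] s fin by (simp add: s_def[symmetric])
  ultimately show ?case
    using Cons.prems(2) by (cases i) (simp_all add: s_def[symmetric])
qed simp

lemma Disp_bound: "\<alpha> \<in> PF \<Longrightarrow> i < length \<alpha> \<Longrightarrow> Disp \<alpha> ! i \<le> i"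
  using disp_bound[OF parkable_PF] by (simp add: Disp_eq_disp)

text \<open>The preferences are chosen so that the cars park in spots \<open>1, 2, \<dots>\<close> in order.\<close>

lemma Disp_surj:
  assumes d: "\<And>i. i < length d \<Longrightarrow> d ! i \<le> i"
  shows "\<exists>\<alpha>\<in>PF. Disp \<alpha> = d"
proof
  let ?N = "length d"
  define \<alpha> where "\<alpha> = map (\<lambda>i. i + 1 - d ! i) [0..<?N]"
  \<comment> \<open>Invariant: when the car with zero-based index \<open>k\<close> arrives, exactly
    the spots \<open>1\<close> to \<open>k\<close> are taken. The induction descends from the empty
    suffix at \<open>k = ?N\<close>.\<close>
  have "disp ?N {1..k} (map (\<lambda>i. i + 1 - d ! i) [k..<?N]) = map ((!) d) [k..<?N]" if "k \<le> ?N" for k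
    using that
  proof (induction k rule: inc_induct)
    case (step k)
    have "Min ({k + 1 - d ! k..?N} - {1..k}) = k + 1"
      using step d[of k] by (intro Min_eqI) auto
    moreover have "insert (Suc k) {1..k} = {1..Suc k}" by auto
    ultimately show ?case
      using step d[of k] by (simp add: upt_conv_Cons)
  qed simp
  from this[of 0] show "Disp \<alpha> = d"
    by (simp add: Disp_eq_disp \<alpha>_def map_nth)
  have "length (filter (\<lambda>a. k < a) \<alpha>) \<le> length \<alpha> - k" for k
  proof -
    \<comment> \<open>Already without sorting, the entry at index \<open>i\<close> is at most
      \<open>i + 1\<close>.\<close>
    have "{i. i < length \<alpha> \<and> k < \<alpha> ! i} \<subseteq> {k..<?N}"
      by (auto simp: \<alpha>_def)
    then have "card {i. i < length \<alpha> \<and> k < \<alpha> ! i} \<le> card {k..<?N}"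
      by (intro card_mono) auto
    then show ?thesis
      by (simp add: length_filter_conv_card \<alpha>_def)
  qed
  moreover have "0 \<notin> set \<alpha>"
    using d by (force simp: \<alpha>_def)
  ultimately show "\<alpha> \<in> PF"
    by (simp add: PF_iff_count)
qed


section \<open>Displacements of shifted shuffles\<close>

text \<open>A car of the first group finds a free spot up to \<open>n\<close>. The shifted occupied
  spots lie strictly beyond \<open>n\<close>, because \<open>O2\<close> omits \<open>0\<close>, and
  the added free spots are larger.\<close>

lemma parkable_Min_left:
  assumes "parkable n O1 (a # as)" "0 \<notin> O2"
  shows "Min ({a..n + m} - (O1 \<union> (\<lambda>b. b + n) ` O2)) = Min ({a..n} - O1)"
proof (rule Min_eqI)
  have s: "Min ({a..n} - O1) \<in> {a..n} - O1"
    by (rule parkable_spot[OF assms(1)])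
  then show "Min ({a..n} - O1) \<in> {a..n + m} - (O1 \<union> (\<lambda>b. b + n) ` O2)"
    using assms(2) by auto
  show "Min ({a..n} - O1) \<le> y" if "y \<in> {a..n + m} - (O1 \<union> (\<lambda>b. b + n) ` O2)" for y
  proof (cases "y \<le> n")
    case True
    with that show ?thesis by (intro Min_le) auto
  next
    case False
    with s show ?thesis by simp
  qed
qed simp

text \<open>Since \<open>b\<close> is positive, the search starts beyond \<open>n\<close> and avoids
  \<open>O1\<close>; the free spots are a translate by \<open>n\<close>, and \<open>Min\<close>
  commutes with translation.\<close>

lemma parkable_Min_right:
  assumes "parkable m O2 (b # bs)" "O1 \<subseteq> {..n}"
  shows "Min ({b + n..n + m} - (O1 \<union> (\<lambda>b. b + n) ` O2)) = Min ({b..m} - O2) + n"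
proof -
  have "0 < b"
    using assms(1) by (auto simp: parkable_def)
  then have "{b + n..n + m} - (O1 \<union> (\<lambda>b. b + n) ` O2) = (\<lambda>b. b + n) ` ({b..m} - O2)"
  proof (intro equalityI subsetI)
    fix y assume "y \<in> {b + n..n + m} - (O1 \<union> (\<lambda>b. b + n) ` O2)"
    then show "y \<in> (\<lambda>b. b + n) ` ({b..m} - O2)"
      by (intro image_eqI[of _ _ "y - n"]) (auto intro: image_eqI[of _ _ "y - n"])
  qed (use assms(2) \<open>0 < b\<close> in auto)
  moreover have "Min ((\<lambda>b. b + n) ` ({b..m} - O2)) = Min ({b..m} - O2) + n"
    using parkable_spot[OF assms(1)]
    by (intro mono_Min_commute[symmetric]) (auto intro: monoI)
  ultimately show ?thesis by simp
qed

lemma parkable_subset: "parkable n occ as \<Longrightarrow> occ \<subseteq> {..n} \<and> 0 \<notin> occ"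
  by (auto simp: parkable_def)

text \<open>The joint occupied set splits into \<open>O1\<close> and the translate of
  \<open>O2\<close>. A first car from \<open>as\<close> changes only \<open>O1\<close>, one from
  \<open>bs\<close> only \<open>O2\<close>, and its displacement is the one on its own street. Hence
  induction along \<open>mshuffles\<close>, for all states.\<close>

lemma disp_mshuffles:
  assumes "parkable n O1 as" "parkable m O2 bs"
  shows "image_mset (disp (n + m) (O1 \<union> (\<lambda>b. b + n) ` O2)) (mshuffles as (map (\<lambda>b. b + n) bs)) =
    mshuffles (disp n O1 as) (disp m O2 bs)"
  using assms
proof (induction as bs arbitrary: O1 O2 rule: mshuffles.induct)
  case (1 bs)
  \<comment> \<open>With one list exhausted a single interleaving remains; an inner induction parks
    its cars while the other group's spots stay fixed.\<close>
  from 1(2) have "disp (n + m) (O1 \<union> (\<lambda>b. b + n) ` O2) (map (\<lambda>b. b + n) bs) = disp m O2 bs"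
  proof (induction bs arbitrary: O2)
    case (Cons b bs)
    note M = parkable_Min_right[OF Cons.prems conjunct1[OF parkable_subset[OF 1(1)]]]
    show ?case
      using Cons.IH[OF parkable_step[OF Cons.prems]] by (simp add: M)
  qed simp
  then show ?case by simp
next
  case (2 a as)
  have "disp (n + m) (O1 \<union> (\<lambda>b. b + n) ` O2) as = disp n O1 as" if "parkable n O1 as" for as
    using that
  proof (induction as arbitrary: O1)
    case (Cons a as)
    note M = parkable_Min_left[OF Cons.prems conjunct2[OF parkable_subset[OF 2(2)]]]
    show ?case
      using Cons.IH[OF parkable_step[OF Cons.prems]] by (simp add: M)
  qed simp
  from this[OF 2(1)] show ?case by simp
next
  case (3 a as b bs)
  note L = parkable_Min_left[OF 3(3) conjunct2[OF parkable_subset[OF 3(4)]], of m]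
  note R = parkable_Min_right[OF 3(4) conjunct1[OF parkable_subset[OF 3(3)]]]
  \<comment> \<open>Interleavings with the same first car \<open>c\<close> share its displacement
    and the occupied set it leaves behind.\<close>
  have comp: "image_mset (disp N occ) (image_mset ((#) c) Z) =
      image_mset ((#) (Min ({c..N} - occ) - c)) (image_mset (disp N (insert (Min ({c..N} - occ)) occ)) Z)"
    for N occ c Z
    by (simp add: image_mset.compositionality comp_def)
  show ?case
    using 3(1)[OF parkable_step[OF 3(3)] 3(4)] 3(2)[OF 3(3) parkable_step[OF 3(4)]]
    by (simp add: comp L R)
qed

text \<open>Without common entries the two possible heads differ, so the two halves of the recursion
  are disjoint and no interleaving repeats.\<close>

lemma mset_set_shuffles:
  "set xs \<inter> set ys = {} \<Longrightarrow> mset_set (shuffles xs ys) = mshuffles xs ys"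
proof (induction xs ys rule: mshuffles.induct)
  case (3 x xs y ys)
  have "mset_set (shuffles (x # xs) (y # ys)) =
      mset_set ((#) x ` shuffles xs (y # ys)) + mset_set ((#) y ` shuffles (x # xs) ys)"
    unfolding shuffles.simps using 3(3) by (intro mset_set_Union) auto
  then show ?case
    using 3 by (simp flip: image_mset_mset_set)
qed simp_all

lemma image_mset_map_mshuffles:
  "image_mset (map f) (mshuffles xs ys) = mshuffles (map f xs) (map f ys)"
proof (induction xs ys rule: mshuffles.induct)
  case (3 x xs y ys)
  have "image_mset (map f) (image_mset ((#) c) Z) = image_mset ((#) (f c)) (image_mset (map f) Z)" for c Z
    by (simp add: image_mset.compositionality comp_def)
  with 3 show ?case by simp
qed simp_all

text \<open>The two groups of cars have disjoint preferences, so the set of shuffles is a multiset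
  without repetitions; \<open>disp_mshuffles\<close> then applies from the empty street. Repetitions
  can appear on the displacement side, hence \<open>mshuffles\<close> there. The right side depends
  only on the displacements, which gives weak shuffle-compatibility.\<close>

lemma Disp_shifted_shuffles:
  assumes "\<alpha> \<in> PF" "\<beta> \<in> PF"
  shows "image_mset Disp (mset_set (shifted_shuffles \<alpha> \<beta>)) = mshuffles (Disp \<alpha>) (Disp \<beta>)"
proof -
  let ?n = "length \<alpha>" and ?m = "length \<beta>"
  \<comment> \<open>The counting condition at \<open>k = ?n\<close> allows no entry above
    \<open>?n\<close>.\<close>
  have "a \<le> ?n" if "a \<in> set \<alpha>" for a
  proof (rule ccontr)
    assume "\<not> a \<le> ?n"
    moreover have "length (filter (\<lambda>a. ?n < a) \<alpha>) \<le> ?n - ?n"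
      using assms(1) unfolding PF_iff_count by blast
    ultimately show False
      using that by (auto simp: filter_empty_conv)
  qed
  moreover have "0 \<notin> set \<beta>"
    using assms(2) by (simp add: PF_def)
  ultimately have "set \<alpha> \<inter> set (map (\<lambda>b. b + ?n) \<beta>) = {}"
    by fastforce
  then have "mset_set (shifted_shuffles \<alpha> \<beta>) = mshuffles \<alpha> (map (\<lambda>b. b + ?n) \<beta>)"
    by (simp add: shifted_shuffles_def mset_set_shuffles)
  moreover have "image_mset Disp (mshuffles \<alpha> (map (\<lambda>b. b + ?n) \<beta>)) =
      image_mset (disp (?n + ?m) {}) (mshuffles \<alpha> (map (\<lambda>b. b + ?n) \<beta>))"
    \<comment> \<open>All interleavings have length \<open>?n + ?m\<close>, so \<open>Disp\<close>
      uses one common street length.\<close>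
    by (intro image_mset_cong) (auto simp: Disp_eq_disp set_mset_mshuffles dest: length_shuffles)
  ultimately show ?thesis
    using disp_mshuffles[OF parkable_PF[OF assms(1)] parkable_PF[OF assms(2)]]
    by (simp add: Disp_eq_disp)
qed

lemma weakly_shuffle_compatible_Disp: "weakly_shuffle_compatible Disp"
  by (simp add: weakly_shuffle_compatible_def Disp_shifted_shuffles)


section \<open>Transport of algebra structures\<close>

text \<open>Each axiom is an equation that holds in \<open>B\<close>; an injective map preserving
  the operations reflects it to \<open>A\<close>.\<close>

lemma algebra_transport:
  fixes R (structure) and A and B
  assumes B: "algebra R B" and inj: "inj_on h (carrier A)"
    and h_carrier: "\<And>x. x \<in> carrier A \<Longrightarrow> h x \<in> carrier B"
    and zero_closed: "\<zero>\<^bsub>A\<^esub> \<in> carrier A"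
    and one_closed: "\<one>\<^bsub>A\<^esub> \<in> carrier A"
    and add_closed: "\<And>x y. x \<in> carrier A \<Longrightarrow> y \<in> carrier A \<Longrightarrow> x \<oplus>\<^bsub>A\<^esub> y \<in> carrier A"
    and mult_closed: "\<And>x y. x \<in> carrier A \<Longrightarrow> y \<in> carrier A \<Longrightarrow> x \<otimes>\<^bsub>A\<^esub> y \<in> carrier A"
    and smult_closed: "\<And>c x. c \<in> carrier R \<Longrightarrow> x \<in> carrier A \<Longrightarrow> c \<odot>\<^bsub>A\<^esub> x \<in> carrier A"
    and h_zero: "h \<zero>\<^bsub>A\<^esub> = \<zero>\<^bsub>B\<^esub>"
    and h_one: "h \<one>\<^bsub>A\<^esub> = \<one>\<^bsub>B\<^esub>"
    and h_add: "\<And>x y. x \<in> carrier A \<Longrightarrow> y \<in> carrier A \<Longrightarrow> h (x \<oplus>\<^bsub>A\<^esub> y) = h x \<oplus>\<^bsub>B\<^esub> h y"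
    and h_mult: "\<And>x y. x \<in> carrier A \<Longrightarrow> y \<in> carrier A \<Longrightarrow> h (x \<otimes>\<^bsub>A\<^esub> y) = h x \<otimes>\<^bsub>B\<^esub> h y"
    and h_smult: "\<And>c x. c \<in> carrier R \<Longrightarrow> x \<in> carrier A \<Longrightarrow> h (c \<odot>\<^bsub>A\<^esub> x) = c \<odot>\<^bsub>B\<^esub> h x"
  shows "algebra R A"
proof -
  interpret BM: cring B by (rule algebra.M_cring[OF B])
  interpret B: algebra R B by (rule B)
  note closed = zero_closed one_closed add_closed mult_closed smult_closed h_carrier
  note hom = h_zero h_one h_add h_mult h_smult
  note eqI = inj_onD[OF inj]
  have "cring A"
  proof (intro cringI abelian_groupI comm_monoidI)
    fix x assume x: "x \<in> carrier A"
    \<comment> \<open>The additive inverse is the scalar multiple by minus one, which stays in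
      \<open>A\<close> by closure under scalars.\<close>
    show "\<exists>y\<in>carrier A. y \<oplus>\<^bsub>A\<^esub> x = \<zero>\<^bsub>A\<^esub>"
      using x by (intro bexI[of _ "(\<ominus> \<one>) \<odot>\<^bsub>A\<^esub> x"] eqI)
        (simp_all add: closed hom B.smult_l_minus BM.l_neg)
  qed (auto intro!: eqI simp: closed hom BM.a_ac BM.m_ac BM.l_distr BM.r_distr)
  then show ?thesis
    by (rule algebraI[OF module.axioms(1)[OF algebra.axioms(1)[OF B]]])
      (auto intro!: eqI simp: closed hom B.smult_l_distr B.smult_r_distr B.smult_assoc1 B.smult_assoc2)
qed


section \<open>Linear extension of maps on basis elements\<close>

definition pm_extend :: "('a \<Rightarrow> pser) \<Rightarrow> ('a \<Rightarrow>\<^sub>0 rat) \<Rightarrow> pser" where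
  "pm_extend F p = (\<Sum>C\<in>Poly_Mapping.keys p. pser_scale (Poly_Mapping.lookup p C) (F C))"

text \<open>Coefficients outside the keys vanish, so elements with different keys can be summed over
  one common index set.\<close>

lemma pm_extend_superset:
  assumes "finite S" "Poly_Mapping.keys p \<subseteq> S"
  shows "pm_extend F p = (\<Sum>C\<in>S. pser_scale (Poly_Mapping.lookup p C) (F C))"
  unfolding pm_extend_def using assms
  by (intro sum.mono_neutral_left) (auto simp: in_keys_iff)

lemma pm_extend_add: "pm_extend F (p + q) = pm_extend F p + pm_extend F q"
proof -
  let ?S = "Poly_Mapping.keys p \<union> Poly_Mapping.keys q"
  have "Poly_Mapping.keys (p + q) \<subseteq> ?S"
    by (rule keys_add)
  then show ?thesis
    by (simp add: pm_extend_superset[where S = ?S] lookup_add pser.scale_left_distrib sum.distrib)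
qed

lemma pm_extend_zero [simp]: "pm_extend F 0 = 0"
  by (simp add: pm_extend_def)

lemma lookup_pm_scale [simp]: "Poly_Mapping.lookup (pm_scale c p) C = c * Poly_Mapping.lookup p C"
  by (simp add: pm_scale_def map.rep_eq when_def)

lemma keys_pm_scale: "Poly_Mapping.keys (pm_scale c p) \<subseteq> Poly_Mapping.keys p"
  by (auto simp: in_keys_iff)

text \<open>Scaling by \<open>0\<close> loses keys, so the sum is first widened to the keys of
  \<open>p\<close>.\<close>

lemma pm_extend_scale: "pm_extend F (pm_scale c p) = pser_scale c (pm_extend F p)"
  by (subst pm_extend_superset[OF _ keys_pm_scale])
    (simp_all add: pm_extend_def pser.scale_sum_right)

lemma pm_extend_single [simp]: "pm_extend F (Poly_Mapping.single C 1) = F C"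
  by (simp add: pm_extend_def)

lemma pm_extend_sum: "pm_extend F (sum g S) = (\<Sum>x\<in>S. pm_extend F (g x))"
  by (induction S rule: infinite_finite_induct) (simp_all add: pm_extend_add)

lemma pser_mult_sum_left: "pser_mult (sum f S) h = (\<Sum>x\<in>S. pser_mult (f x) h)"
proof (induction S rule: infinite_finite_induct)
  case (insert x S)
  then show ?case by (simp only: sum.insert[OF insert(1,2)] pser_mult_add)
qed (simp_all add: pser_mult_def fun_eq_iff)

lemma pser_mult_sum_right: "pser_mult h (sum f S) = (\<Sum>x\<in>S. pser_mult h (f x))"
  unfolding pser_mult_commute[of h] by (rule pser_mult_sum_left)

lemma pser_mult_scale_right: "pser_mult f (pser_scale c g) = pser_scale c (pser_mult f g)"
  unfolding pser_mult_commute[of f] by (rule pser_mult_scale)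


section \<open>The isomorphism\<close>

definition disp_of_class :: "nat list set \<Rightarrow> nat list" where
  "disp_of_class C = Disp (SOME \<alpha>. \<alpha> \<in> C)"

lemma pf_class_self: "\<alpha> \<in> PF \<Longrightarrow> \<alpha> \<in> pf_class st \<alpha>"
  by (simp add: pf_class_def)

text \<open>A displacement sequence already determines the length of its parking function.\<close>

lemma pf_class_Disp_eqI: "Disp \<alpha> = Disp \<beta> \<Longrightarrow> pf_class Disp \<alpha> = pf_class Disp \<beta>"
  using length_Disp[of \<alpha>] length_Disp[of \<beta>] by (simp add: pf_class_def)

lemma disp_of_class [simp]: "\<alpha> \<in> PF \<Longrightarrow> disp_of_class (pf_class Disp \<alpha>) = Disp \<alpha>"
  using someI[where P = "\<lambda>x. x \<in> pf_class Disp \<alpha>", OF pf_class_self]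
  by (simp add: disp_of_class_def pf_class_def)

lemma inj_on_disp_of_class: "inj_on disp_of_class (pf_class Disp ` PF)"
  by (auto intro!: inj_onI pf_class_Disp_eqI)

lemma Disp_bounded_compositions:
  "\<alpha> \<in> PF \<Longrightarrow> map Suc (Disp \<alpha>) \<in> bounded_compositions"
  by (auto simp: bounded_compositions_def compositions_def Disp_bound)

text \<open>Lowering every entry by one gives a sequence that \<open>Disp_surj\<close> realizes;
  positivity of the entries makes the truncated subtraction reversible.\<close>

lemma bounded_compositions_Disp:
  assumes "\<delta> \<in> bounded_compositions"
  obtains \<alpha> where "\<alpha> \<in> PF" "\<delta> = map Suc (Disp \<alpha>)"
proof -
  have "\<exists>\<alpha>\<in>PF. Disp \<alpha> = map (\<lambda>i. i - 1) \<delta>"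
    using assms by (intro Disp_surj) (auto simp: bounded_compositions_def)
  then obtain \<alpha> where "\<alpha> \<in> PF" "Disp \<alpha> = map (\<lambda>i. i - 1) \<delta>"
    by blast
  moreover have "map Suc (map (\<lambda>i. i - 1) \<delta>) = \<delta>"
  proof -
    have "0 < i" if "i \<in> set \<delta>" for i
      using assms that by (cases i) (auto simp: bounded_compositions_def compositions_def)
    then show ?thesis
      by (simp add: map_idI)
  qed
  ultimately show ?thesis
    using that by metis
qed

section \<open>The linear map and closure of the product of classes\<close>

definition Disp_hom :: "(nat list \<Rightarrow> pser) \<Rightarrow> (nat list set \<Rightarrow>\<^sub>0 rat) \<Rightarrow> pser" where
  "Disp_hom B = pm_extend (\<lambda>C. B (map Suc (disp_of_class C)))"

lemma Disp_hom_class_elem: "\<alpha> \<in> PF \<Longrightarrow> Disp_hom B (class_elem Disp \<alpha>) = B (map Suc (Disp \<alpha>))"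
  by (simp add: Disp_hom_def)

lemma some_in_class:
  "C \<in> pf_class st ` PF \<Longrightarrow> (SOME \<alpha>. \<alpha> \<in> C) \<in> PF"
  using someI[where P = "\<lambda>x. x \<in> C"] pf_class_self by (fastforce simp: pf_class_def)

lemma keys_sum_subset:
  "(\<And>x. x \<in> S \<Longrightarrow> Poly_Mapping.keys (g x) \<subseteq> K) \<Longrightarrow> Poly_Mapping.keys (sum g S) \<subseteq> K"
  using keys_sum[of g S] by blast

lemma keys_class_prod:
  assumes "C \<in> pf_class st ` PF" "D \<in> pf_class st ` PF"
  shows "Poly_Mapping.keys (class_prod st C D) \<subseteq> pf_class st ` PF"
  unfolding class_prod_def using shifted_shuffles_PF[OF some_in_class some_in_class, OF assms]
  by (intro keys_sum_subset) auto

lemma shuffle_algebra_mult_closed: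
  assumes "p \<in> carrier (shuffle_algebra st)" "q \<in> carrier (shuffle_algebra st)"
  shows "p \<otimes>\<^bsub>shuffle_algebra st\<^esub> q \<in> carrier (shuffle_algebra st)"
proof -
  have "Poly_Mapping.keys (pm_scale c (class_prod st C D)) \<subseteq> pf_class st ` PF"
    if "C \<in> Poly_Mapping.keys p" "D \<in> Poly_Mapping.keys q" for c C D
    using keys_pm_scale keys_class_prod[of C st D] assms that
    by (fastforce simp: shuffle_algebra_def)
  then show ?thesis
    unfolding shuffle_algebra_def by (simp add: keys_sum_subset)
qed

section \<open>Multiplicativity for a fixed shuffle basis\<close>

context
  fixes B :: "nat list \<Rightarrow> pser"
  assumes B: "shuffle_basis B"
begin

lemma basis_mult:
  "\<delta> \<in> compositions \<Longrightarrow> \<eta> \<in> compositions \<Longrightarrow> pser_mult (B \<delta>) (B \<eta>) = (\<Sum>\<iota>\<in>#mshuffles \<delta> \<eta>. B \<iota>)"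
  using B by (simp add: shuffle_basis_def QSym_def)

text \<open>The empty sequence has a single interleaving with any \<open>\<delta>\<close>, so
  \<open>B []\<close> acts as the identity on the span of the basis. That span is all of
  \<open>QSym\<close> and contains \<open>pser_one\<close>.\<close>

lemma basis_Nil: "B [] = pser_one"
proof -
  have "pser_mult (B []) f = f" if "f \<in> pser.span (B ` compositions)" for f
    using that
  proof (induction rule: pser.span_induct_alt)
    case base
    show ?case by (simp add: pser_mult_def fun_eq_iff)
  next
    case (step c f g)
    from step(1) obtain \<delta> where "\<delta> \<in> compositions" "f = B \<delta>" by blast
    then have "pser_mult (B []) f = f"
      using basis_mult[of "[]" \<delta>] by (simp add: compositions_def)
    then show ?case
      using step(2)
      unfolding pser_mult_commute[of "B []"] pser_mult_add pser_mult_scale by simp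
  qed
  moreover have "pser_one \<in> pser.span (B ` compositions)"
    using B cring.cring_simprules(6)[OF cring_QSym] by (simp add: shuffle_basis_def QSym_def)
  ultimately have "pser_mult (B []) pser_one = pser_one"
    by blast
  then show ?thesis
    by (metis pser_mult_commute pser_mult_one)
qed

lemma Disp_hom_class_prod:
  assumes "C \<in> pf_class Disp ` PF" "D \<in> pf_class Disp ` PF"
  shows "Disp_hom B (class_prod Disp C D) =
    pser_mult (B (map Suc (disp_of_class C))) (B (map Suc (disp_of_class D)))"
proof -
  \<comment> \<open>These are the representatives chosen by \<open>class_prod\<close> and by
    \<open>disp_of_class\<close> alike.\<close>
  define \<alpha> \<beta> where "\<alpha> = (SOME \<alpha>. \<alpha> \<in> C)" and "\<beta> = (SOME \<beta>. \<beta> \<in> D)"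
  have PF: "\<alpha> \<in> PF" "\<beta> \<in> PF"
    using assms some_in_class by (auto simp: \<alpha>_def \<beta>_def)
  have "Disp_hom B (class_prod Disp C D) =
      (\<Sum>\<gamma>\<in>shifted_shuffles \<alpha> \<beta>. Disp_hom B (class_elem Disp \<gamma>))"
    unfolding class_prod_def \<alpha>_def[symmetric] \<beta>_def[symmetric]
    by (simp add: Disp_hom_def pm_extend_sum)
  also have "\<dots> = (\<Sum>\<gamma>\<in>shifted_shuffles \<alpha> \<beta>. B (map Suc (Disp \<gamma>)))"
    using shifted_shuffles_PF[OF PF] by (intro sum.cong) (auto simp: Disp_hom_class_elem)
  also have "\<dots> = (\<Sum>\<iota>\<in>#image_mset (map Suc) (image_mset Disp (mset_set (shifted_shuffles \<alpha> \<beta>))). B \<iota>)"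
    by (simp add: sum_unfold_sum_mset image_mset.compositionality comp_def)
  also have "\<dots> = pser_mult (B (map Suc (Disp \<alpha>))) (B (map Suc (Disp \<beta>)))"
    unfolding Disp_shifted_shuffles[OF PF] image_mset_map_mshuffles
    by (subst basis_mult) (auto simp: compositions_def)
  finally show ?thesis
    by (simp add: disp_of_class_def \<alpha>_def \<beta>_def)
qed

lemma Disp_hom_mult:
  assumes "p \<in> carrier (shuffle_algebra Disp)" "q \<in> carrier (shuffle_algebra Disp)"
  shows "Disp_hom B (p \<otimes>\<^bsub>shuffle_algebra Disp\<^esub> q) = pser_mult (Disp_hom B p) (Disp_hom B q)"
proof -
  let ?F = "\<lambda>C. B (map Suc (disp_of_class C))"
  have "Disp_hom B (p \<otimes>\<^bsub>shuffle_algebra Disp\<^esub> q) =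
    (\<Sum>C\<in>Poly_Mapping.keys p. \<Sum>D\<in>Poly_Mapping.keys q.
      pser_scale (Poly_Mapping.lookup p C * Poly_Mapping.lookup q D) (Disp_hom B (class_prod Disp C D)))"
    by (simp add: shuffle_algebra_def Disp_hom_def pm_extend_sum pm_extend_scale)
  also have "\<dots> = (\<Sum>C\<in>Poly_Mapping.keys p. \<Sum>D\<in>Poly_Mapping.keys q.
      pser_scale (Poly_Mapping.lookup p C * Poly_Mapping.lookup q D) (pser_mult (?F C) (?F D)))"
    using assms
    by (intro sum.cong refl arg_cong2[where f = pser_scale] Disp_hom_class_prod)
      (auto simp: shuffle_algebra_def)
  also have "\<dots> = pser_mult (Disp_hom B p) (Disp_hom B q)"
    by (simp add: Disp_hom_def pm_extend_def pser_mult_sum_left pser_mult_sum_right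
        pser_mult_scale pser_mult_scale_right pser.scale_sum_right mult.commute)
      (rule sum.swap)
  finally show ?thesis .
qed

section \<open>Injectivity and image\<close>

lemma inj_on_basis_class: "inj_on (\<lambda>C. B (map Suc (disp_of_class C))) (pf_class Disp ` PF)"
proof (rule inj_onI)
  fix C D
  assume *: "C \<in> pf_class Disp ` PF" "D \<in> pf_class Disp ` PF"
    "B (map Suc (disp_of_class C)) = B (map Suc (disp_of_class D))"
  have "inj_on B compositions"
    using B by (simp add: shuffle_basis_def)
  then have "map Suc (disp_of_class C) = map Suc (disp_of_class D)"
    by (rule inj_onD) (use *(3) in \<open>auto simp: compositions_def\<close>)
  then show "C = D"
    using inj_onD[OF inj_on_disp_of_class] * by (auto simp: inj_map_eq_map)
qed

lemma inj_on_Disp_hom: "inj_on (Disp_hom B) (carrier (shuffle_algebra Disp))"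
proof (rule inj_onI)
  let ?F = "\<lambda>C. B (map Suc (disp_of_class C))"
  fix p q
  assume pq: "p \<in> carrier (shuffle_algebra Disp)" "q \<in> carrier (shuffle_algebra Disp)"
    and eq: "Disp_hom B p = Disp_hom B q"
  define S where "S = Poly_Mapping.keys p \<union> Poly_Mapping.keys q"
  have S: "finite S" "S \<subseteq> pf_class Disp ` PF"
    using pq by (auto simp: S_def shuffle_algebra_def)
  have inj: "inj_on ?F S"
    using inj_on_basis_class S(2) by (rule inj_on_subset)
  \<comment> \<open>Independence concerns coefficients attached to vectors, so those of
    \<open>p - q\<close> are carried from classes to vectors by the inverse of \<open>?F\<close> on
    \<open>S\<close>.\<close>
  define u where
    "u v = Poly_Mapping.lookup p (the_inv_into S ?F v) - Poly_Mapping.lookup q (the_inv_into S ?F v)" for v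
  have u: "u (?F C) = Poly_Mapping.lookup p C - Poly_Mapping.lookup q C" if "C \<in> S" for C
    using that by (simp add: u_def the_inv_into_f_f[OF inj])
  have "(\<Sum>v\<in>?F ` S. pser_scale (u v) v) =
      (\<Sum>C\<in>S. pser_scale (Poly_Mapping.lookup p C - Poly_Mapping.lookup q C) (?F C))"
    using inj by (simp add: sum.reindex u)
  also have "\<dots> = Disp_hom B p - Disp_hom B q"
    using S(1) unfolding Disp_hom_def
    by (simp add: pm_extend_superset[where S = S] S_def pser.scale_left_diff_distrib sum_subtractf)
  finally have "(\<Sum>v\<in>?F ` S. pser_scale (u v) v) = 0"
    using eq by simp
  moreover have "pser.independent (B ` compositions)" "?F ` S \<subseteq> B ` compositions"
    using B by (auto simp: shuffle_basis_def compositions_def)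
  ultimately have "u (?F C) = 0" if "C \<in> S" for C
    using pser.independentD[of "B ` compositions" "?F ` S" u "?F C"] S(1) that by blast
  then have "Poly_Mapping.lookup p C = Poly_Mapping.lookup q C" if "C \<in> S" for C
    using u that by fastforce
  then show "p = q"
    by (intro poly_mapping_eqI) (metis S_def UnI1 UnI2 in_keys_iff)
qed

text \<open>Displacements of parking functions are bounded, so values stay in the span. Conversely
  the image is a subspace, and every bounded composition comes from some parking function.\<close>

lemma Disp_hom_image:
  "Disp_hom B ` carrier (shuffle_algebra Disp) = pser.span (B ` bounded_compositions)"
proof (intro equalityI)
  show "Disp_hom B ` carrier (shuffle_algebra Disp) \<subseteq> pser.span (B ` bounded_compositions)"
  proof
    fix f assume "f \<in> Disp_hom B ` carrier (shuffle_algebra Disp)"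
    then obtain p where p: "Poly_Mapping.keys p \<subseteq> pf_class Disp ` PF" "f = Disp_hom B p"
      by (auto simp: shuffle_algebra_def)
    have "B (map Suc (disp_of_class C)) \<in> pser.span (B ` bounded_compositions)"
      if "C \<in> Poly_Mapping.keys p" for C
      using that p(1) by (intro pser.span_base) (auto simp: Disp_bounded_compositions)
    then show "f \<in> pser.span (B ` bounded_compositions)"
      unfolding p(2) Disp_hom_def pm_extend_def
      by (intro pser.span_sum pser.span_scale)
  qed
next
  show "pser.span (B ` bounded_compositions) \<subseteq> Disp_hom B ` carrier (shuffle_algebra Disp)"
  proof (rule pser.span_minimal)
    show "B ` bounded_compositions \<subseteq> Disp_hom B ` carrier (shuffle_algebra Disp)"
    proof
      fix f assume "f \<in> B ` bounded_compositions"
      then obtain \<alpha> where "\<alpha> \<in> PF" "f = B (map Suc (Disp \<alpha>))"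
        using bounded_compositions_Disp by blast
      then show "f \<in> Disp_hom B ` carrier (shuffle_algebra Disp)"
        by (intro image_eqI[of _ _ "class_elem Disp \<alpha>"])
          (auto simp: Disp_hom_class_elem shuffle_algebra_def)
    qed
    show "pser.subspace (Disp_hom B ` carrier (shuffle_algebra Disp))"
    proof (rule pser.subspaceI)
      show "0 \<in> Disp_hom B ` carrier (shuffle_algebra Disp)"
        by (rule image_eqI[of _ _ 0]) (auto simp: Disp_hom_def shuffle_algebra_def)
    next
      fix f g
      assume "f \<in> Disp_hom B ` carrier (shuffle_algebra Disp)"
        "g \<in> Disp_hom B ` carrier (shuffle_algebra Disp)"
      then obtain p q where pq: "p \<in> carrier (shuffle_algebra Disp)" "q \<in> carrier (shuffle_algebra Disp)"
        "f = Disp_hom B p" "g = Disp_hom B q" by blast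
      then show "f + g \<in> Disp_hom B ` carrier (shuffle_algebra Disp)"
        using keys_add[of p q]
        by (intro image_eqI[of _ _ "p + q"]) (auto simp: Disp_hom_def shuffle_algebra_def pm_extend_add)
    next
      fix c f
      assume "f \<in> Disp_hom B ` carrier (shuffle_algebra Disp)"
      then obtain p where "p \<in> carrier (shuffle_algebra Disp)" "f = Disp_hom B p" by blast
      then show "pser_scale c f \<in> Disp_hom B ` carrier (shuffle_algebra Disp)"
        using keys_pm_scale[of c p]
        by (intro image_eqI[of _ _ "pm_scale c p"])
          (auto simp: Disp_hom_def shuffle_algebra_def pm_extend_scale)
    qed
  qed
qed

section \<open>Algebra structure, isomorphism and subalgebra\<close>

lemma span_bounded_subset: "pser.span (B ` bounded_compositions) \<subseteq> carrier QSym"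
proof -
  have "carrier QSym = pser.span (B ` compositions)"
    using B by (simp add: shuffle_basis_def)
  then show ?thesis
    by (auto simp: bounded_compositions_def intro!: pser.span_mono)
qed

lemma Nil_PF: "[] \<in> PF"
  by (simp add: PF_def)

lemma Disp_hom_one: "Disp_hom B (class_elem Disp []) = pser_one"
  using Disp_hom_class_elem[OF Nil_PF] by (simp add: basis_Nil Disp_eq_disp)

lemma Disp_hom_iso:
  "Disp_hom B \<in> algebra_iso rat_ring (shuffle_algebra Disp)
    (QSym\<lparr>carrier := pser.span (B ` bounded_compositions)\<rparr>)"
proof -
  have "Disp_hom B \<in> ring_iso (shuffle_algebra Disp)
    (QSym\<lparr>carrier := pser.span (B ` bounded_compositions)\<rparr>)"
  proof (rule ring_iso_memI)
    show "bij_betw (Disp_hom B) (carrier (shuffle_algebra Disp))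
      (carrier (QSym\<lparr>carrier := pser.span (B ` bounded_compositions)\<rparr>))"
      by (simp add: bij_betw_def inj_on_Disp_hom Disp_hom_image)
  next
    fix p q assume "p \<in> carrier (shuffle_algebra Disp)" "q \<in> carrier (shuffle_algebra Disp)"
    then show "Disp_hom B (p \<otimes>\<^bsub>shuffle_algebra Disp\<^esub> q) =
      Disp_hom B p \<otimes>\<^bsub>QSym\<lparr>carrier := pser.span (B ` bounded_compositions)\<rparr>\<^esub> Disp_hom B q"
      by (subst Disp_hom_mult) (simp_all add: QSym_def)
  qed (simp_all add: Disp_hom_image[symmetric],
      simp_all add: shuffle_algebra_def QSym_def Disp_hom_one, simp_all add: Disp_hom_def pm_extend_add)
  then show ?thesis
    by (simp add: algebra_iso_def shuffle_algebra_def QSym_def Disp_hom_def pm_extend_scale)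
qed

text \<open>\<open>Disp_hom B\<close> embeds the shuffle algebra into \<open>QSym\<close>, from
  which associativity and commutativity are pulled back.\<close>

lemma algebra_shuffle_algebra_Disp: "algebra rat_ring (shuffle_algebra Disp)"
proof (rule algebra_transport[OF algebra_QSym inj_on_Disp_hom])
  let ?A = "shuffle_algebra Disp"
  show "Disp_hom B p \<in> carrier QSym" if "p \<in> carrier ?A" for p
    using that Disp_hom_image span_bounded_subset by blast
  show "p \<otimes>\<^bsub>?A\<^esub> q \<in> carrier ?A" if "p \<in> carrier ?A" "q \<in> carrier ?A" for p q
    using that by (rule shuffle_algebra_mult_closed)
  show "Disp_hom B (p \<otimes>\<^bsub>?A\<^esub> q) = Disp_hom B p \<otimes>\<^bsub>QSym\<^esub> Disp_hom B q"
    if "p \<in> carrier ?A" "q \<in> carrier ?A" for p q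
    using Disp_hom_mult[OF that] by (simp add: QSym_def)
  show "p \<oplus>\<^bsub>?A\<^esub> q \<in> carrier ?A" if "p \<in> carrier ?A" "q \<in> carrier ?A" for p q
    using that keys_add[of p q] by (auto simp: shuffle_algebra_def)
  show "c \<odot>\<^bsub>?A\<^esub> p \<in> carrier ?A" if "p \<in> carrier ?A" for c p
    using that keys_pm_scale[of c p] by (auto simp: shuffle_algebra_def)
qed (simp_all add: shuffle_algebra_def QSym_def Disp_hom_one Nil_PF,
    simp_all add: Disp_hom_def pm_extend_add pm_extend_scale)

text \<open>The span is the image of \<open>Disp_hom B\<close>, so a product of two of its elements
  is the image of a product of preimages. Negatives are scalar multiples by minus one.\<close>

lemma subalgebra_bounded: "subalgebra_of rat_ring (pser.span (B ` bounded_compositions)) QSym"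
proof -
  interpret QSym: algebra rat_ring QSym by (rule algebra_QSym)
  let ?S = "pser.span (B ` bounded_compositions)"
  have smult: "c \<odot>\<^bsub>QSym\<^esub> f \<in> ?S" if "f \<in> ?S" for c f
    using that by (simp add: QSym_def pser.span_scale)
  have minus: "\<ominus>\<^bsub>QSym\<^esub> f \<in> ?S" if "f \<in> ?S" for f
  proof -
    have "\<ominus>\<^bsub>QSym\<^esub> f = (\<ominus>\<^bsub>rat_ring\<^esub> \<one>\<^bsub>rat_ring\<^esub>) \<odot>\<^bsub>QSym\<^esub> f"
      using span_bounded_subset that by (subst QSym.smult_l_minus) auto
    then show ?thesis
      using smult[OF that] by simp
  qed
  have add: "f \<oplus>\<^bsub>QSym\<^esub> g \<in> ?S" if "f \<in> ?S" "g \<in> ?S" for f g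
    using that by (simp add: QSym_def pser.span_add)
  have mult: "f \<otimes>\<^bsub>QSym\<^esub> g \<in> ?S" if fg: "f \<in> ?S" "g \<in> ?S" for f g
  proof -
    obtain p q where pq: "p \<in> carrier (shuffle_algebra Disp)" "q \<in> carrier (shuffle_algebra Disp)"
      "f = Disp_hom B p" "g = Disp_hom B q"
      using fg unfolding Disp_hom_image[symmetric] by blast
    then have "f \<otimes>\<^bsub>QSym\<^esub> g = Disp_hom B (p \<otimes>\<^bsub>shuffle_algebra Disp\<^esub> q)"
      by (simp only: Disp_hom_mult) (simp add: QSym_def)
    then show ?thesis
      using shuffle_algebra_mult_closed[OF pq(1,2)] Disp_hom_image by blast
  qed
  have "B [] \<in> ?S"
    by (intro pser.span_base) (simp add: bounded_compositions_def compositions_def)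
  then have one: "\<one>\<^bsub>QSym\<^esub> \<in> ?S"
    by (simp add: QSym_def basis_Nil)
  have zero: "\<zero>\<^bsub>QSym\<^esub> \<in> ?S"
    by (simp add: QSym_def pser.span_zero)
  show ?thesis
    unfolding subalgebra_of_def
    using ring.subringI[OF cring.axioms(1)[OF cring_QSym] span_bounded_subset one minus mult add]
      QSym.submoduleI[OF span_bounded_subset zero minus add smult] by blast
qed

end

theorem theorem4p9:
  shows "weakly_shuffle_compatible Disp \<and>
    (\<forall>B. shuffle_basis B \<longrightarrow>
      algebra rat_ring (shuffle_algebra Disp) \<and>
      subalgebra_of rat_ring (pser.span (B ` bounded_compositions)) QSym \<and>
      (\<exists>\<phi> \<in> algebra_iso rat_ring (shuffle_algebra Disp)
                (QSym\<lparr>carrier := pser.span (B ` bounded_compositions)\<rparr>).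
        \<forall>\<alpha>\<in>PF. \<phi> (class_elem Disp \<alpha>) = B (map Suc (Disp \<alpha>))))"
  using weakly_shuffle_compatible_Disp algebra_shuffle_algebra_Disp subalgebra_bounded
    Disp_hom_iso Disp_hom_class_elem
  by blast

end
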